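(* Let $(M,g)$ be the Robinson–Trautman spacetime with coordinates $(t,r,x,y)$, constants $a,b,d\in\mathbb R$ and function $f=f(x,y)$, and let $\mu_1,\mu_2\in\mathbb R$ be constants. If $f_x^2+f_y^2-f(f_{xx}+f_{yy})-2a+4br\neq0$ on $M$ and $$\begin{aligned}&\mu_2\big[-2f_y^3+f_y\{4a-16br-2f_x^2+f(3f_{yy}+f_{xx})\}-f\{-2f_xf_{xy}+f(f_{yyy}+f_{xxy})\}\big]\\&+\mu_1\big[-2f_x^3+f_x\{4a-16br-2f_y^2+f(f_{yy}+3f_{xx})\}-f\{-2f_yf_{xy}+f(f_{xxx}+f_{xyy})\}\big]=0\end{aligned}$$ on $M$, then the spacetime possesses Ricci collineation with respect to $\xi=\mu_1\frac{\partial}{\partial x}+\mu_2\frac{\partial}{\partial y}$, i.e. $\mathscr L_\xi S=0$.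
   Context: Robinson–Trautman (RT) spacetime: $a,b,d\in\mathbb R$ are constants; $M=I\times J\times\Omega$ with coordinates $(x^1,x^2,x^3,x^4)=(t,r,x,y)$, where $I\subset\mathbb R$ and $J\subset\mathbb R\setminus\{0\}$ are open intervals and $\Omega\subset\mathbb R^2$ is open, connected and nonempty; $f:\Omega\to\mathbb R$ is smooth and nowhere vanishing, with subscripts denoting partial derivatives; the metric is $$g=-2\Big(a-2br-\frac dr\Big)dt^2+2\,dt\,dr-\frac{r^2}{f^2}(dx^2+dy^2).$$ ($2\,dt\,dr$ means $g_{12}=g_{21}=1$.) Curvature conventions: with $\Gamma$ the Levi-Civita connection coefficients, $R_{pqrs}=g_{p\alpha}(\partial_r\Gamma^\alpha_{qs}-\partial_s\Gamma^\alpha_{qr}+\Gamma^\beta_{qs}\Gamma^\alpha_{\beta r}-\Gamma^\beta_{qr}\Gamma^\alpha_{\beta s})$ and $S_{qr}=g^{ps}R_{pqrs}$ is the Ricci tensor. With this convention, writing $F_1=f_x^2+f_y^2-f(f_{xx}+f_{yy})$, the nonzero components of $S$ (up to symmetry) are $S_{11}=-\frac{8b(d+r(-a+2br))}{r^2}$, $S_{12}=-\frac{4b}{r}$, $S_{33}=S_{44}=\frac{F_1-2a+8br}{f^2}$. $\mathscr L_\xi$ is the Lie derivative. *)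

theory Defs
  imports "HOL-Analysis.Analysis"
begin

section \<open>Coordinate calculus on open subsets of real n-space\<close>

definition pderiv_at :: "'n::finite \<Rightarrow> (real^'n \<Rightarrow> real) \<Rightarrow> real^'n \<Rightarrow> real"
  where "pderiv_at i F p = deriv (\<lambda>s. F (p + s *\<^sub>R axis i 1)) 0"

primrec C_k_on :: "nat \<Rightarrow> (real^'n::finite \<Rightarrow> real) \<Rightarrow> (real^'n) set \<Rightarrow> bool"
  where
    "C_k_on 0 F U \<longleftrightarrow> continuous_on U F"
  | "C_k_on (Suc k) F U \<longleftrightarrow>
       (\<forall>p\<in>U. F differentiable (at p)) \<and> (\<forall>i. C_k_on k (pderiv_at i F) U)"

text \<open>Intended for open \<open>U\<close>, since the derivatives are taken in the ambient space.\<close>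

definition smooth_on :: "(real^'n::finite \<Rightarrow> real) \<Rightarrow> (real^'n) set \<Rightarrow> bool"
  where "smooth_on F U \<longleftrightarrow> (\<forall>k. C_k_on k F U)"

text \<open>A covariant 2-tensor field, in particular a metric, is given by its component matrix at each
  point; a vector field by its component vector.\<close>

type_synonym 'n tensor2 = "real^'n \<Rightarrow> real^'n^'n"
type_synonym 'n vfield = "real^'n \<Rightarrow> real^'n"

text \<open>\<open>christoffel g k i j\<close> is \<open>\<Gamma>\<close> with upper index \<open>k\<close> and lower indices \<open>i\<close>, \<open>j\<close>; the inverse
  metric has the components of \<open>matrix_inv (g p)\<close>.\<close>

definition christoffel :: "'n::finite tensor2 \<Rightarrow> 'n \<Rightarrow> 'n \<Rightarrow> 'n \<Rightarrow> real^'n \<Rightarrow> real"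
  where "christoffel g k i j p =
    (\<Sum>l\<in>UNIV. matrix_inv (g p) $ k $ l *
       (pderiv_at i (\<lambda>z. g z $ j $ l) p
        + pderiv_at j (\<lambda>z. g z $ i $ l) p
        - pderiv_at l (\<lambda>z. g z $ i $ j) p)) / 2"

text \<open>\<open>riemann g p q r s\<close> is the lowered-index component \<open>R\<^sub>p\<^sub>q\<^sub>r\<^sub>s\<close>, with derivative indices \<open>r\<close>, \<open>s\<close>;
  the Ricci tensor contracts the first with the last index. With this convention its sign is opposite
  to that of the usual contraction of the first with the third index.\<close>

definition riemann :: "'n::finite tensor2 \<Rightarrow> 'n \<Rightarrow> 'n \<Rightarrow> 'n \<Rightarrow> 'n \<Rightarrow> real^'n \<Rightarrow> real"
  where "riemann g p q r s z =
    (\<Sum>\<alpha>\<in>UNIV. g z $ p $ \<alpha> *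
       (pderiv_at r (christoffel g \<alpha> q s) z - pderiv_at s (christoffel g \<alpha> q r) z
        + (\<Sum>\<beta>\<in>UNIV. christoffel g \<beta> q s z * christoffel g \<alpha> \<beta> r z
                   - christoffel g \<beta> q r z * christoffel g \<alpha> \<beta> s z)))"

definition ricci :: "'n::finite tensor2 \<Rightarrow> 'n tensor2"
  where "ricci g z =
    (\<chi> q r. \<Sum>p\<in>UNIV. \<Sum>s\<in>UNIV. matrix_inv (g z) $ p $ s * riemann g p q r s z)"

definition lie_deriv :: "'n::finite vfield \<Rightarrow> 'n tensor2 \<Rightarrow> 'n tensor2"
  where "lie_deriv \<xi> T p =
    (\<chi> i j. \<Sum>k\<in>UNIV.
        \<xi> p $ k * pderiv_at k (\<lambda>z. T z $ i $ j) p
        + T p $ k $ j * pderiv_at i (\<lambda>z. \<xi> z $ k) p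
        + T p $ i $ k * pderiv_at j (\<lambda>z. \<xi> z $ k) p)"

definition ricci_collineation_on :: "(real^'n::finite) set \<Rightarrow> 'n tensor2 \<Rightarrow> 'n vfield \<Rightarrow> bool"
  where "ricci_collineation_on M g \<xi> \<longleftrightarrow> (\<forall>p\<in>M. lie_deriv \<xi> (ricci g) p = 0)"


section \<open>Robinson--Trautman spacetime\<close>

text \<open>Points of the spacetime are vectors \<open>p\<close> with \<open>p $ 1 = t\<close>, \<open>p $ 2 = r\<close>, \<open>p $ 3 = x\<close>,
  \<open>p $ 4 = y\<close>.\<close>

definition xy_part :: "real^4 \<Rightarrow> real^2"
  where "xy_part p = vector [p $ 3, p $ 4]"

definition RT_domain :: "real set \<Rightarrow> real set \<Rightarrow> (real^2) set \<Rightarrow> (real^4) set"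
  where "RT_domain I J \<Omega> = {p. p $ 1 \<in> I \<and> p $ 2 \<in> J \<and> xy_part p \<in> \<Omega>}"

definition RT_metric :: "real \<Rightarrow> real \<Rightarrow> real \<Rightarrow> (real^2 \<Rightarrow> real) \<Rightarrow> 4 tensor2"
  where "RT_metric a b d f p =
    (let r = p $ 2; h = - (r\<^sup>2 / (f (xy_part p))\<^sup>2) in
     vector [vector [- 2 * (a - 2 * b * r - d / r), 1, 0, 0],
             vector [1, 0, 0, 0],
             vector [0, 0, h, 0],
             vector [0, 0, 0, h]])"

definition RT_spacetime ::
  "real set \<Rightarrow> real set \<Rightarrow> (real^2) set \<Rightarrow> (real^2 \<Rightarrow> real) \<Rightarrow> bool"
  where "RT_spacetime I J \<Omega> f \<longleftrightarrow>
    open I \<and> is_interval I \<and> I \<noteq> {} \<and>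
    open J \<and> is_interval J \<and> J \<noteq> {} \<and> 0 \<notin> J \<and>
    open \<Omega> \<and> connected \<Omega> \<and> \<Omega> \<noteq> {} \<and>
    smooth_on f \<Omega> \<and> (\<forall>q\<in>\<Omega>. f q \<noteq> 0)"

text \<open>Partial derivatives of functions of \<open>(x, y)\<close>; for iterated ones, \<open>f\<^sub>x\<^sub>y\<close> is \<open>pdy (pdx f)\<close>.\<close>

abbreviation pdx :: "(real^2 \<Rightarrow> real) \<Rightarrow> real^2 \<Rightarrow> real"
  where "pdx \<equiv> pderiv_at 1"

abbreviation pdy :: "(real^2 \<Rightarrow> real) \<Rightarrow> real^2 \<Rightarrow> real"
  where "pdy \<equiv> pderiv_at 2"

end

theory Submission
  imports Defs
begin

text \<open>Since \<open>\<xi>\<close> has constant components, \<open>\<L>\<^sub>\<xi> S\<close> is obtained by applying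
  \<open>\<mu>\<^sub>1 \<partial>\<^sub>x + \<mu>\<^sub>2 \<partial>\<^sub>y\<close> to each component of the Ricci tensor \<open>S\<close>. The components \<open>S\<^sub>1\<^sub>1\<close> and \<open>S\<^sub>1\<^sub>2\<close> are
  functions of \<open>r\<close> alone, and the only others that do not vanish are
  \<open>S\<^sub>3\<^sub>3 = S\<^sub>4\<^sub>4 = (f\<^sub>x\<^sup>2 + f\<^sub>y\<^sup>2 - f (f\<^sub>x\<^sub>x + f\<^sub>y\<^sub>y) - 2a + 8br) / f\<^sup>2\<close>. So the collineation condition is one
  scalar equation, \<open>\<mu>\<^sub>1 \<partial>\<^sub>x S\<^sub>3\<^sub>3 + \<mu>\<^sub>2 \<partial>\<^sub>y S\<^sub>3\<^sub>3 = 0\<close>; multiplied by \<open>f\<^sup>3\<close> it is the assumed differential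
  equation.

  Most of the work is in computing \<open>S\<close> (lemma \<open>ricci_g\<close>). Because \<open>g\<close> is symmetric and invertible, the
  lowered and raised indices in the definition of the Ricci tensor cancel, and \<open>S\<close> is the plain contraction
  of the curvature in terms of the Christoffel symbols (\<open>ricci_eq_contraction\<close>). The Christoffel symbols are
  elementary expressions in \<open>r\<close>, \<open>f\<close>, \<open>f\<^sub>x\<close>, \<open>f\<^sub>y\<close> on the whole of the open set \<open>M\<close>
  (\<open>christoffel_g\<close>), so they may be differentiated through these expressions.

  Symmetry of mixed partial derivatives (\<open>pderiv_at_commute\<close>) enters twice: it makes \<open>S\<^sub>3\<^sub>4\<close> vanish, and
  it brings the mixed derivatives of \<open>f\<close> in \<open>\<partial>\<^sub>x S\<^sub>3\<^sub>3\<close> into the order in which the differential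
  equation has them. It is proved with the classical second difference, which the mean value theorem
  expresses through either mixed derivative.\<close>

section \<open>Matrices and partial derivatives\<close>

lemma vector_4 [simp]:
  "(vector [x, y, z, w] :: 'a::zero^4) $ 1 = x"
  "(vector [x, y, z, w] :: 'a::zero^4) $ 2 = y"
  "(vector [x, y, z, w] :: 'a::zero^4) $ 3 = z"
  "(vector [x, y, z, w] :: 'a::zero^4) $ 4 = w"
  unfolding vector_def by auto

lemma matrix_inv_eqI:
  fixes A B :: "real^'n^'n"
  assumes "A ** B = mat 1"
  shows "matrix_inv A = B"
proof -
  have BA: "B ** A = mat 1"
    using assms matrix_left_right_inverse by blast
  have "A ** matrix_inv A = mat 1"
    unfolding matrix_inv_def
    using someI[of "\<lambda>A'. A ** A' = mat 1 \<and> A' ** A = mat 1" B] assms BA by blast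
  then have "B ** (A ** matrix_inv A) = B" by simp
  then show ?thesis by (simp add: matrix_mul_assoc BA)
qed

text \<open>The directional derivatives are taken at an arbitrary point of the line, so that the mean value theorem
  can be applied along coordinate lines.\<close>

lemma has_derivative_along_axis:
  fixes F :: "real^'n::finite \<Rightarrow> real"
  assumes "(F has_derivative F') (at (p + s *\<^sub>R axis i 1))"
  shows "((\<lambda>\<sigma>. F (p + \<sigma> *\<^sub>R axis i 1)) has_real_derivative F' (axis i 1)) (at s)"
proof -
  interpret F': bounded_linear F' using assms by (rule has_derivative_bounded_linear)
  have line: "((\<lambda>\<sigma>. p + \<sigma> *\<^sub>R axis i 1) has_derivative (\<lambda>h. h *\<^sub>R axis i 1)) (at s)"
    by (auto intro!: derivative_eq_intros)
  show ?thesis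
    using has_derivative_compose[OF line assms]
    by (simp add: F'.scaleR has_field_derivative_def mult_commute_abs)
qed

lemma pderiv_at_eqI:
  assumes "(F has_derivative F') (at p)"
  shows "pderiv_at i F p = F' (axis i 1)"
  unfolding pderiv_at_def
  using has_derivative_along_axis[of F F' p 0 i] assms by (auto intro: DERIV_imp_deriv)

lemma pderiv_at_line:
  assumes "F differentiable (at (p + s *\<^sub>R axis i 1))"
  shows "((\<lambda>\<sigma>. F (p + \<sigma> *\<^sub>R axis i 1)) has_real_derivative pderiv_at i F (p + s *\<^sub>R axis i 1)) (at s)"
  using assms unfolding differentiable_def
  by (metis has_derivative_along_axis pderiv_at_eqI)

text \<open>A partial derivative at a point sees only the germ of the function. This allows a function to be replaced,
  under a derivative, by a formula valid only on an open set.\<close>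

lemma pderiv_at_cong_open:
  assumes "open U" "p \<in> U" "\<And>q. q \<in> U \<Longrightarrow> F q = G q"
  shows "pderiv_at i F p = pderiv_at i G p"
proof -
  have "open ((\<lambda>s. p + s *\<^sub>R axis i 1) -` U)"
    using assms(1) by (intro open_vimage continuous_intros)
  then have "\<forall>\<^sub>F s in nhds 0. p + s *\<^sub>R axis i 1 \<in> U"
    unfolding eventually_nhds using assms(2)
    by (intro exI[of _ "(\<lambda>s. p + s *\<^sub>R axis i 1) -` U"]) simp
  then have "\<forall>\<^sub>F s in nhds 0. F (p + s *\<^sub>R axis i 1) = G (p + s *\<^sub>R axis i 1)"
    by eventually_elim (rule assms(3))
  then show ?thesis
    unfolding pderiv_at_def by (rule deriv_cong_ev) simp
qed

lemma smooth_on_differentiable: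
  assumes "smooth_on F U" "p \<in> U"
  shows "F differentiable (at p)"
  using assms unfolding smooth_on_def by (metis C_k_on.simps(2))

lemma smooth_on_pderiv_at:
  assumes "smooth_on F U"
  shows "smooth_on (pderiv_at i F) U"
  using assms unfolding smooth_on_def by (metis C_k_on.simps(2))

lemma smooth_on_continuous_on:
  assumes "smooth_on F U"
  shows "continuous_on U F"
  using assms unfolding smooth_on_def by (metis C_k_on.simps(1))

text \<open>Two applications of the mean value theorem, in direction \<open>i\<close> to
  \<open>\<sigma> \<mapsto> F (p + \<sigma> e\<^sub>i + s e\<^sub>j) - F (p + \<sigma> e\<^sub>i)\<close> and then in direction \<open>j\<close> to \<open>\<partial>\<^sub>i F\<close>.
  The left-hand side is symmetric in \<open>i\<close> and \<open>j\<close>, which is what makes the mixed derivatives agree.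
  The bound \<open>2 s < \<delta>\<close> keeps the square with corner \<open>p\<close> and side \<open>s\<close>, also when it degenerates
  to a segment for \<open>i = j\<close>, inside the ball.\<close>

lemma second_difference_mean_value:
  fixes F :: "real^'n::finite \<Rightarrow> real"
  assumes diff: "\<And>q. q \<in> ball p \<delta> \<Longrightarrow> F differentiable (at q)"
    and diff': "\<And>q. q \<in> ball p \<delta> \<Longrightarrow> pderiv_at i F differentiable (at q)"
    and s: "0 < s" "2 * s < \<delta>"
  shows "\<exists>q \<in> ball p \<delta>.
      F (p + s *\<^sub>R axis i 1 + s *\<^sub>R axis j 1) - F (p + s *\<^sub>R axis i 1) - F (p + s *\<^sub>R axis j 1) + F p
        = s\<^sup>2 * pderiv_at j (pderiv_at i F) q"
proof -
  let ?P = "\<lambda>\<sigma> \<tau>. p + \<sigma> *\<^sub>R axis i 1 + \<tau> *\<^sub>R axis j 1"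
  have near: "?P \<sigma> \<tau> \<in> ball p \<delta>" if "0 \<le> \<sigma>" "\<sigma> \<le> s" "0 \<le> \<tau>" "\<tau> \<le> s" for \<sigma> \<tau>
  proof -
    have "dist p (?P \<sigma> \<tau>) = norm (\<sigma> *\<^sub>R axis i 1 + \<tau> *\<^sub>R axis j (1::real))"
      unfolding dist_norm by (subst norm_minus_cancel[symmetric]) (simp add: add.assoc del: norm_minus_cancel)
    also have "\<dots> \<le> \<sigma> + \<tau>"
      using norm_triangle_ineq[of "\<sigma> *\<^sub>R axis i (1::real)" "\<tau> *\<^sub>R axis j 1"] that
      by (simp add: norm_axis_1)
    finally show ?thesis using that s by simp
  qed
  have line: "((\<lambda>\<sigma>. F (?P \<sigma> \<tau>)) has_real_derivative pderiv_at i F (?P \<sigma> \<tau>)) (at \<sigma>)"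
    if "0 \<le> \<sigma>" "\<sigma> \<le> s" "0 \<le> \<tau>" "\<tau> \<le> s" for \<sigma> \<tau>
  proof -
    have swap: "p + \<tau> *\<^sub>R axis j 1 + \<sigma> *\<^sub>R axis i 1 = ?P \<sigma> \<tau>" for \<sigma> by simp
    show ?thesis
      using pderiv_at_line[of F "p + \<tau> *\<^sub>R axis j 1" \<sigma> i] diff[OF near[OF that]]
      unfolding swap by blast
  qed
  have "\<exists>\<sigma>>0. \<sigma> < s \<and> (F (?P s s) - F (?P s 0)) - (F (?P 0 s) - F (?P 0 0))
      = (s - 0) * (pderiv_at i F (?P \<sigma> s) - pderiv_at i F (?P \<sigma> 0))"
  proof (rule MVT2[where f = "\<lambda>\<sigma>. F (?P \<sigma> s) - F (?P \<sigma> 0)"])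
    fix \<sigma> assume "0 \<le> \<sigma>" "\<sigma> \<le> s"
    then show "((\<lambda>\<sigma>. F (?P \<sigma> s) - F (?P \<sigma> 0)) has_real_derivative
        pderiv_at i F (?P \<sigma> s) - pderiv_at i F (?P \<sigma> 0)) (at \<sigma>)"
      using s by (intro DERIV_diff line) auto
  qed (use s in simp)
  then obtain \<sigma> where \<sigma>: "0 < \<sigma>" "\<sigma> < s" and
    first: "(F (?P s s) - F (?P s 0)) - (F (?P 0 s) - F (?P 0 0))
      = s * (pderiv_at i F (?P \<sigma> s) - pderiv_at i F (?P \<sigma> 0))"
    by auto
  have "\<exists>\<tau>>0. \<tau> < s \<and> pderiv_at i F (?P \<sigma> s) - pderiv_at i F (?P \<sigma> 0)
      = (s - 0) * pderiv_at j (pderiv_at i F) (?P \<sigma> \<tau>)"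
    using \<sigma> s by (intro MVT2 pderiv_at_line diff' near) auto
  then obtain \<tau> where \<tau>: "0 < \<tau>" "\<tau> < s" and
    "pderiv_at i F (?P \<sigma> s) - pderiv_at i F (?P \<sigma> 0) = s * pderiv_at j (pderiv_at i F) (?P \<sigma> \<tau>)"
    by auto
  with first have "F (?P s s) - F (?P s 0) - F (?P 0 s) + F (?P 0 0)
      = s\<^sup>2 * pderiv_at j (pderiv_at i F) (?P \<sigma> \<tau>)"
    by (simp add: power2_eq_square)
  then show ?thesis
    using near[of \<sigma> \<tau>] \<sigma> \<tau> by (intro bexI[of _ "?P \<sigma> \<tau>"]) auto
qed

text \<open>If the two mixed derivatives differed at \<open>p\<close>, their values near \<open>p\<close> would be separated by
  continuity; but the symmetric second difference is \<open>s\<^sup>2\<close> times a value of each of them near \<open>p\<close>.\<close>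

theorem pderiv_at_commute:
  fixes F :: "real^'n::finite \<Rightarrow> real"
  assumes F: "smooth_on F U" and U: "open U" "p \<in> U"
  shows "pderiv_at i (pderiv_at j F) p = pderiv_at j (pderiv_at i F) p"
proof (rule ccontr)
  let ?A = "pderiv_at j (pderiv_at i F)" and ?B = "pderiv_at i (pderiv_at j F)"
  define \<epsilon> where "\<epsilon> = \<bar>?A p - ?B p\<bar> / 2"
  assume "?B p \<noteq> ?A p"
  then have "\<epsilon> > 0" by (simp add: \<epsilon>_def)
  have cont: "isCont (pderiv_at k (pderiv_at l F)) p" for k l
    using smooth_on_continuous_on[OF smooth_on_pderiv_at[OF smooth_on_pderiv_at[OF F]]] U
    by (auto simp: continuous_on_eq_continuous_at)
  obtain \<delta>0 where \<delta>0: "\<delta>0 > 0" "ball p \<delta>0 \<subseteq> U"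
    using U open_contains_ball by blast
  obtain \<delta>A where \<delta>A: "\<delta>A > 0" "\<And>q. dist q p < \<delta>A \<Longrightarrow> dist (?A q) (?A p) < \<epsilon>"
    using cont \<open>\<epsilon> > 0\<close> unfolding continuous_at_eps_delta by blast
  obtain \<delta>B where \<delta>B: "\<delta>B > 0" "\<And>q. dist q p < \<delta>B \<Longrightarrow> dist (?B q) (?B p) < \<epsilon>"
    using cont \<open>\<epsilon> > 0\<close> unfolding continuous_at_eps_delta by blast
  define \<delta> where "\<delta> = min \<delta>0 (min \<delta>A \<delta>B)"
  have \<delta>: "\<delta> > 0" "ball p \<delta> \<subseteq> U"
    using \<delta>0 \<delta>A \<delta>B by (auto simp: \<delta>_def)
  define s where "s = \<delta> / 3"
  have s: "0 < s" "2 * s < \<delta>" using \<delta> by (auto simp: s_def)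
  have mean_value: "\<exists>q \<in> ball p \<delta>.
      F (p + s *\<^sub>R axis k 1 + s *\<^sub>R axis l 1) - F (p + s *\<^sub>R axis k 1) - F (p + s *\<^sub>R axis l 1) + F p
        = s\<^sup>2 * pderiv_at l (pderiv_at k F) q" for k l
    using \<delta>(2) by (intro second_difference_mean_value s)
      (blast intro: smooth_on_differentiable smooth_on_pderiv_at F)+
  obtain q where q: "q \<in> ball p \<delta>" and
    A: "F (p + s *\<^sub>R axis i 1 + s *\<^sub>R axis j 1) - F (p + s *\<^sub>R axis i 1) - F (p + s *\<^sub>R axis j 1) + F p
      = s\<^sup>2 * ?A q"
    using mean_value[of i j] by blast
  obtain q' where q': "q' \<in> ball p \<delta>" and
    B: "F (p + s *\<^sub>R axis j 1 + s *\<^sub>R axis i 1) - F (p + s *\<^sub>R axis j 1) - F (p + s *\<^sub>R axis i 1) + F p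
      = s\<^sup>2 * ?B q'"
    using mean_value[of j i] by blast
  have swap: "p + s *\<^sub>R axis j 1 + s *\<^sub>R axis i 1 = p + s *\<^sub>R axis i 1 + s *\<^sub>R axis j 1"
    by (simp add: add.assoc add.commute)
  have "s\<^sup>2 * ?A q = s\<^sup>2 * ?B q'"
    using A B[unfolded swap] by linarith
  then have "?A q = ?B q'" using s by simp
  moreover have "dist (?A q) (?A p) < \<epsilon>" "dist (?B q') (?B p) < \<epsilon>"
    by (rule \<delta>A \<delta>B; use q q' in \<open>simp add: \<delta>_def dist_commute\<close>)+
  ultimately have "\<bar>?A p - ?B p\<bar> < 2 * \<epsilon>"
    by (simp add: dist_real_def)
  then show False by (simp add: \<epsilon>_def)
qed

section \<open>The Ricci tensor as a contraction\<close>

text \<open>The definition lowers the upper index \<open>\<alpha>\<close> of the curvature with \<open>g\<close> and then raises it with the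
  inverse metric. For symmetric \<open>g\<close> the two steps cancel, leaving the trace over \<open>\<alpha> = s\<close>.\<close>

lemma ricci_eq_contraction:
  fixes g :: "'n::finite tensor2"
  assumes sym: "transpose (g z) = g z" and inv: "g z ** B = mat 1"
  shows "ricci g z $ q $ r =
    (\<Sum>s\<in>UNIV. pderiv_at r (christoffel g s q s) z - pderiv_at s (christoffel g s q r) z
      + (\<Sum>\<beta>\<in>UNIV. christoffel g \<beta> q s z * christoffel g s \<beta> r z
                 - christoffel g \<beta> q r z * christoffel g s \<beta> s z))"
proof -
  let ?X = "\<lambda>\<alpha> s. pderiv_at r (christoffel g \<alpha> q s) z - pderiv_at s (christoffel g \<alpha> q r) z
      + (\<Sum>\<beta>\<in>UNIV. christoffel g \<beta> q s z * christoffel g \<alpha> \<beta> r z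
                 - christoffel g \<beta> q r z * christoffel g \<alpha> \<beta> s z)"
  have delta: "(\<Sum>p\<in>UNIV. B $ p $ s * g z $ p $ \<alpha>) = (if \<alpha> = s then 1 else 0)" for s \<alpha>
  proof -
    have "(\<Sum>p\<in>UNIV. B $ p $ s * g z $ p $ \<alpha>) = (transpose (g z) ** B) $ \<alpha> $ s"
      by (simp add: matrix_matrix_mult_def transpose_def mult.commute)
    then show ?thesis by (simp add: sym inv mat_def)
  qed
  have "ricci g z $ q $ r = (\<Sum>p\<in>UNIV. \<Sum>s\<in>UNIV. B $ p $ s * (\<Sum>\<alpha>\<in>UNIV. g z $ p $ \<alpha> * ?X \<alpha> s))"
    by (simp add: ricci_def riemann_def matrix_inv_eqI[OF inv])
  also have "\<dots> = (\<Sum>s\<in>UNIV. \<Sum>p\<in>UNIV. \<Sum>\<alpha>\<in>UNIV. B $ p $ s * g z $ p $ \<alpha> * ?X \<alpha> s)"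
    by (subst sum.swap) (simp add: sum_distrib_left mult.assoc)
  also have "\<dots> = (\<Sum>s\<in>UNIV. \<Sum>\<alpha>\<in>UNIV. \<Sum>p\<in>UNIV. B $ p $ s * g z $ p $ \<alpha> * ?X \<alpha> s)"
    by (intro sum.cong refl sum.swap)
  also have "\<dots> = (\<Sum>s\<in>UNIV. \<Sum>\<alpha>\<in>UNIV. (\<Sum>p\<in>UNIV. B $ p $ s * g z $ p $ \<alpha>) * ?X \<alpha> s)"
    by (simp only: sum_distrib_right)
  also have "\<dots> = (\<Sum>s\<in>UNIV. ?X s s)"
    by (simp add: delta if_distrib[of "\<lambda>c. c * _"] cong: if_cong)
  finally show ?thesis .
qed

section \<open>Calculus in the coordinates \<open>(t, r, x, y)\<close>\<close>

text \<open>Nothing below depends on \<open>t\<close>, hence the vanishing first entry. Reading all partial derivatives off one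
  total derivative lets the differentiation rules do the computation once for all four directions.\<close>

lemma pderiv_at_gradient4:
  assumes "(F has_derivative (\<lambda>h. A * h $ 2 + B * h $ 3 + C * h $ 4)) (at (p::real^4))"
  shows "pderiv_at k F p = vector [0, A, B, C] $ k"
  using exhaust_4[of k] by (auto simp: pderiv_at_eqI[OF assms] axis_def)

lemma has_derivative_coordinate: "((\<lambda>z::real^'n::finite. z $ i) has_derivative (\<lambda>h. h $ i)) F"
  by (intro bounded_linear_imp_has_derivative bounded_linear_vec_nth)

lemma xy_part_eq: "xy_part z = z $ 3 *\<^sub>R axis 1 1 + z $ 4 *\<^sub>R axis 2 1"
  by (simp add: xy_part_def vec_eq_iff forall_2 axis_def)

lemma has_derivative_comp_xy_part:
  assumes "u differentiable (at (xy_part p))"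
  shows "((\<lambda>z. u (xy_part z)) has_derivative
    (\<lambda>h. pdx u (xy_part p) * h $ 3 + pdy u (xy_part p) * h $ 4)) (at p)"
proof -
  obtain u' where u': "(u has_derivative u') (at (xy_part p))"
    using assms by (auto simp: differentiable_def)
  interpret u': bounded_linear u' using u' by (rule has_derivative_bounded_linear)
  have "(xy_part has_derivative (\<lambda>h. h $ 3 *\<^sub>R axis 1 1 + h $ 4 *\<^sub>R axis 2 1)) (at p)"
    unfolding xy_part_eq[abs_def] by (auto intro!: derivative_eq_intros has_derivative_coordinate)
  from has_derivative_compose[OF this u'] show ?thesis
    by (simp add: u'.add u'.scaleR pderiv_at_eqI[OF u'] mult.commute)
qed

lemma open_RT_domain:
  assumes "open I" "open J" "open \<Omega>"
  shows "open (RT_domain I J \<Omega>)"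
proof -
  have "continuous_on UNIV xy_part"
    unfolding xy_part_eq[abs_def] by (intro continuous_intros)
  then have "open (((\<lambda>p. p $ 1) -` I) \<inter> ((\<lambda>p. p $ 2) -` J) \<inter> (xy_part -` \<Omega>))"
    using assms by (intro open_Int open_vimage continuous_intros) auto
  also have "((\<lambda>p. p $ 1) -` I) \<inter> ((\<lambda>p. p $ 2) -` J) \<inter> (xy_part -` \<Omega>) = RT_domain I J \<Omega>"
    by (auto simp: RT_domain_def)
  finally show ?thesis .
qed

section \<open>Connection and Ricci tensor of the Robinson--Trautman metric\<close>

locale Robinson_Trautman =
  fixes a b d :: real and I J :: "real set" and \<Omega> :: "(real^2) set" and f :: "real^2 \<Rightarrow> real"
  assumes RT: "RT_spacetime I J \<Omega> f"
begin

abbreviation "M \<equiv> RT_domain I J \<Omega>"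
abbreviation "g \<equiv> RT_metric a b d f"
abbreviation "u p \<equiv> f (xy_part p)"
abbreviation "ux p \<equiv> pdx f (xy_part p)"
abbreviation "uy p \<equiv> pdy f (xy_part p)"

text \<open>The coefficient of \<open>dt\<^sup>2\<close> is \<open>-2 N\<close>; \<open>N'\<close> is \<open>dN/dr\<close>. They are defined rather than abbreviated, so that
  the differentiation rules treat them as atoms and the tables below stay small.\<close>

definition N :: "real^4 \<Rightarrow> real" where "N p = a - 2 * b * p $ 2 - d / p $ 2"
definition N' :: "real^4 \<Rightarrow> real" where "N' p = d / (p $ 2)\<^sup>2 - 2 * b"

lemma open_M: "open M"
  using RT by (auto simp: RT_spacetime_def intro: open_RT_domain)

lemma smooth_f: "smooth_on f \<Omega>" and open_\<Omega>: "open \<Omega>"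
  using RT by (auto simp: RT_spacetime_def)

lemma M_cond: "p \<in> M \<Longrightarrow> p $ 2 \<noteq> 0" "p \<in> M \<Longrightarrow> u p \<noteq> 0" "p \<in> M \<Longrightarrow> xy_part p \<in> \<Omega>"
  using RT by (auto simp: RT_spacetime_def RT_domain_def)

lemma deriv_xy:
  assumes "p \<in> M" "smooth_on v \<Omega>"
  shows "((\<lambda>z. v (xy_part z)) has_derivative
    (\<lambda>h. pdx v (xy_part p) * h $ 3 + pdy v (xy_part p) * h $ 4)) (at p)"
  by (intro has_derivative_comp_xy_part smooth_on_differentiable[OF assms(2) M_cond(3)[OF assms(1)]])

lemmas deriv_f = deriv_xy[OF _ smooth_f]
  and deriv_fx = deriv_xy[OF _ smooth_on_pderiv_at[OF smooth_f, of 1]]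
  and deriv_fy = deriv_xy[OF _ smooth_on_pderiv_at[OF smooth_f, of 2]]

lemma deriv_N: "p \<in> M \<Longrightarrow> (N has_derivative (\<lambda>h. N' p * h $ 2)) (at p)"
  using M_cond[of p] unfolding N_def[abs_def] N'_def
  by (auto intro!: derivative_eq_intros has_derivative_coordinate simp: field_simps power2_eq_square)

lemma deriv_N': "p \<in> M \<Longrightarrow> (N' has_derivative (\<lambda>h. - 2 * d / (p $ 2)^3 * h $ 2)) (at p)"
  using M_cond[of p] unfolding N'_def[abs_def]
  by (auto intro!: derivative_eq_intros has_derivative_coordinate simp: field_simps power2_eq_square power3_eq_cube)

lemmas deriv_rules = derivative_eq_intros has_derivative_coordinate deriv_f deriv_fx deriv_fy deriv_N deriv_N'

lemma transpose_g: "transpose (g p) = g p"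
  by (simp add: RT_metric_def Let_def vec_eq_iff forall_4 transpose_def)

definition ginv :: "4 tensor2" where
  "ginv p = vector [vector [0, 1, 0, 0],
                    vector [1, 2 * N p, 0, 0],
                    vector [0, 0, - ((u p)\<^sup>2 / (p $ 2)\<^sup>2), 0],
                    vector [0, 0, 0, - ((u p)\<^sup>2 / (p $ 2)\<^sup>2)]]"

lemma g_mult_ginv: "p \<in> M \<Longrightarrow> g p ** ginv p = mat 1"
  using M_cond[of p]
  by (simp add: RT_metric_def ginv_def N_def Let_def vec_eq_iff forall_4 matrix_matrix_mult_def sum_4 mat_def
      field_simps)

lemma pderiv_g:
  assumes "p \<in> M"
  shows "pderiv_at k (\<lambda>z. g z $ i $ j) p =
    (if i = 1 \<and> j = 1 then vector [0, - 2 * N' p, 0, 0] $ k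
     else if i = j \<and> i \<noteq> 2 then
       vector [0, - 2 * p $ 2 / (u p)\<^sup>2, 2 * (p $ 2)\<^sup>2 * ux p / (u p)^3, 2 * (p $ 2)\<^sup>2 * uy p / (u p)^3] $ k
     else 0)"
proof -
  note M_cond[OF assms, simp]
  have N: "pderiv_at k (\<lambda>z. - 2 * N z) p = vector [0, - 2 * N' p, 0, 0] $ k"
    using assms by (intro pderiv_at_gradient4)
      (auto intro!: deriv_rules simp: field_simps power2_eq_square)
  have h: "pderiv_at k (\<lambda>z. - ((z $ 2)\<^sup>2 / (u z)\<^sup>2)) p =
    vector [0, - 2 * p $ 2 / (u p)\<^sup>2, 2 * (p $ 2)\<^sup>2 * ux p / (u p)^3, 2 * (p $ 2)\<^sup>2 * uy p / (u p)^3] $ k"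
    using assms by (intro pderiv_at_gradient4)
      (auto intro!: deriv_rules simp: field_simps power2_eq_square power3_eq_cube)
  have const: "pderiv_at k (\<lambda>z. c) p = 0" for c
    by (simp add: pderiv_at_def)
  show ?thesis
    using exhaust_4[of i] exhaust_4[of j] N h const
    by (auto simp: RT_metric_def N_def Let_def)
qed

text \<open>\<open>christoffel_table k p $ i $ j\<close> is \<open>\<Gamma>\<close> with upper index \<open>k\<close> and lower indices \<open>i\<close>, \<open>j\<close>. The lower right
  blocks for \<open>k = 3, 4\<close> are the connection of the conformally flat surface metric
  \<open>(dx\<^sup>2 + dy\<^sup>2) / f\<^sup>2\<close>.\<close>

definition christoffel_table :: "4 \<Rightarrow> 4 tensor2" where
  "christoffel_table k p = vector
    [vector [vector [N' p, 0, 0, 0],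
             vector [0, 0, 0, 0],
             vector [0, 0, p $ 2 / (u p)\<^sup>2, 0],
             vector [0, 0, 0, p $ 2 / (u p)\<^sup>2]],
     vector [vector [2 * N p * N' p, - N' p, 0, 0],
             vector [- N' p, 0, 0, 0],
             vector [0, 0, 2 * N p * p $ 2 / (u p)\<^sup>2, 0],
             vector [0, 0, 0, 2 * N p * p $ 2 / (u p)\<^sup>2]],
     vector [vector [0, 0, 0, 0],
             vector [0, 0, 1 / p $ 2, 0],
             vector [0, 1 / p $ 2, - (ux p / u p), - (uy p / u p)],
             vector [0, 0, - (uy p / u p), ux p / u p]],
     vector [vector [0, 0, 0, 0],
             vector [0, 0, 0, 1 / p $ 2],
             vector [0, 0, uy p / u p, - (ux p / u p)],
             vector [0, 1 / p $ 2, - (ux p / u p), - (uy p / u p)]]] $ k"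

lemma christoffel_g:
  assumes "p \<in> M"
  shows "christoffel g k i j p = christoffel_table k p $ i $ j"
proof -
  note M_cond[OF assms, simp]
  have "\<forall>k i j. christoffel g k i j p = christoffel_table k p $ i $ j"
    unfolding christoffel_def matrix_inv_eqI[OF g_mult_ginv[OF assms]] pderiv_g[OF assms] forall_4 sum_4
    by (simp add: ginv_def christoffel_table_def power2_eq_square power3_eq_cube)
  then show ?thesis by blast
qed

lemma pderiv_christoffel_g:
  assumes "p \<in> M"
  shows "pderiv_at l (christoffel g k i j) p = pderiv_at l (\<lambda>z. christoffel_table k z $ i $ j) p"
  using open_M assms by (rule pderiv_at_cong_open) (rule christoffel_g)

abbreviation "uxx p \<equiv> pdx (pdx f) (xy_part p)"
abbreviation "uxy p \<equiv> pdy (pdx f) (xy_part p)"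
abbreviation "uyy p \<equiv> pdy (pdy f) (xy_part p)"

lemma pdx_pdy: "p \<in> M \<Longrightarrow> pdx (pdy f) (xy_part p) = uxy p"
  using smooth_f open_\<Omega> M_cond(3) by (rule pderiv_at_commute)

text \<open>The gradients of the functions occurring in \<open>christoffel_table\<close>, each in the syntactic form in which it occurs
  there, so that they rewrite the derivatives of the Christoffel symbols directly.\<close>

lemma pderiv_christoffel_table_entries:
  assumes "p \<in> M"
  shows "pderiv_at k (\<lambda>z. c) p = 0"
    and "pderiv_at k (\<lambda>z. N' z) p = vector [0, - 2 * d / (p $ 2)^3, 0, 0] $ k"
    and "pderiv_at k (\<lambda>z. - N' z) p = vector [0, 2 * d / (p $ 2)^3, 0, 0] $ k"
    and "pderiv_at k (\<lambda>z. 2 * N z * N' z) p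
      = vector [0, 2 * (N' p)\<^sup>2 - 4 * d * N p / (p $ 2)^3, 0, 0] $ k"
    and "pderiv_at k (\<lambda>z. z $ 2 / (u z)\<^sup>2) p
      = vector [0, 1 / (u p)\<^sup>2, - 2 * p $ 2 * ux p / (u p)^3, - 2 * p $ 2 * uy p / (u p)^3] $ k"
    and "pderiv_at k (\<lambda>z. 2 * N z * z $ 2 / (u z)\<^sup>2) p
      = vector [0, 2 * (N' p * p $ 2 + N p) / (u p)\<^sup>2,
                - 4 * N p * p $ 2 * ux p / (u p)^3, - 4 * N p * p $ 2 * uy p / (u p)^3] $ k"
    and "pderiv_at k (\<lambda>z. 1 / z $ 2) p = vector [0, - 1 / (p $ 2)\<^sup>2, 0, 0] $ k"
    and "pderiv_at k (\<lambda>z. ux z / u z) p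
      = vector [0, 0, uxx p / u p - (ux p)\<^sup>2 / (u p)\<^sup>2, uxy p / u p - ux p * uy p / (u p)\<^sup>2] $ k"
    and "pderiv_at k (\<lambda>z. uy z / u z) p
      = vector [0, 0, uxy p / u p - ux p * uy p / (u p)\<^sup>2, uyy p / u p - (uy p)\<^sup>2 / (u p)\<^sup>2] $ k"
    and "pderiv_at k (\<lambda>z. - (ux z / u z)) p
      = vector [0, 0, (ux p)\<^sup>2 / (u p)\<^sup>2 - uxx p / u p, ux p * uy p / (u p)\<^sup>2 - uxy p / u p] $ k"
    and "pderiv_at k (\<lambda>z. - (uy z / u z)) p
      = vector [0, 0, ux p * uy p / (u p)\<^sup>2 - uxy p / u p, (uy p)\<^sup>2 / (u p)\<^sup>2 - uyy p / u p] $ k"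
  subgoal by (simp add: pderiv_at_def)
  \<comment> \<open>\<open>\<lambda>z. N' z\<close> is the atom \<open>N'\<close>, which no differentiation rule decomposes.\<close>
  subgoal by (rule pderiv_at_gradient4) (use deriv_N'[OF assms] in simp)
  by (rule pderiv_at_gradient4,
      (use assms M_cond[OF assms] pdx_pdy[OF assms] in
        \<open>auto intro!: deriv_rules simp: field_simps power2_eq_square power3_eq_cube\<close>)[])+

definition S33 :: "real^4 \<Rightarrow> real" where
  "S33 p = ((ux p)\<^sup>2 + (uy p)\<^sup>2 - u p * (uxx p + uyy p) - 2 * a + 8 * b * p $ 2) / (u p)\<^sup>2"

definition ricci_table :: "4 tensor2" where
  "ricci_table p = (let r = p $ 2 in
    vector [vector [- 8 * b * (d + r * (- a + 2 * b * r)) / r\<^sup>2, - 4 * b / r, 0, 0],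
            vector [- 4 * b / r, 0, 0, 0],
            vector [0, 0, S33 p, 0],
            vector [0, 0, 0, S33 p]])"

text \<open>Each component is a rational identity in \<open>r\<close>, \<open>f\<close> and the derivatives of \<open>f\<close> once the Christoffel symbols
  and their derivatives are substituted. The \<open>(3,4)\<close> component is
  \<open>\<partial>\<^sub>x (f\<^sub>y / f) - \<partial>\<^sub>y (f\<^sub>x / f)\<close>, which vanishes by symmetry of the second derivatives.\<close>

lemma ricci_g:
  assumes "p \<in> M"
  shows "ricci g p = ricci_table p"
proof -
  note M_cond[OF assms, simp]
  have "\<forall>q r. ricci g p $ q $ r = ricci_table p $ q $ r"
    unfolding ricci_eq_contraction[where g = g and z = p, OF transpose_g g_mult_ginv[OF assms]]
      pderiv_christoffel_g[OF assms] christoffel_g[OF assms] forall_4 sum_4 christoffel_table_def vector_4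
      pderiv_christoffel_table_entries[OF assms]
    unfolding ricci_table_def S33_def Let_def N_def N'_def
    by (intro conjI; simp add: power2_eq_square power3_eq_cube; simp add: field_simps)
  then show ?thesis by (simp add: vec_eq_iff)
qed

section \<open>The Lie derivative of the Ricci tensor\<close>

lemma pdx_pdy_pdy: "p \<in> M \<Longrightarrow> pdx (pdy (pdy f)) (xy_part p) = pdy (pdy (pdx f)) (xy_part p)"
proof -
  assume p: "p \<in> M"
  have "pdx (pdy (pdy f)) (xy_part p) = pdy (pdx (pdy f)) (xy_part p)"
    using smooth_on_pderiv_at[OF smooth_f] open_\<Omega> M_cond(3)[OF p] by (rule pderiv_at_commute)
  also have "\<dots> = pdy (pdy (pdx f)) (xy_part p)"
    using open_\<Omega> M_cond(3)[OF p] by (rule pderiv_at_cong_open) (rule pderiv_at_commute[OF smooth_f open_\<Omega>])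
  finally show ?thesis .
qed

lemmas deriv_fxx = deriv_xy[OF _ smooth_on_pderiv_at[OF smooth_on_pderiv_at[OF smooth_f, of 1], of 1]]
  and deriv_fyy = deriv_xy[OF _ smooth_on_pderiv_at[OF smooth_on_pderiv_at[OF smooth_f, of 2], of 2]]

text \<open>The numerators are the coefficients of \<open>\<mu>\<^sub>1\<close> and \<open>\<mu>\<^sub>2\<close> in the differential equation. With
  \<open>S33 = E / f\<^sup>2\<close> they arise as \<open>f E\<^sub>x - 2 f\<^sub>x E\<close> and \<open>f E\<^sub>y - 2 f\<^sub>y E\<close>.\<close>

lemma pderiv_S33:
  assumes "p \<in> M"
  defines "q \<equiv> xy_part p"
  shows "pderiv_at 3 S33 p =
      (- 2 * ux p ^ 3 + ux p * (4 * a - 16 * b * p $ 2 - 2 * (uy p)\<^sup>2 + u p * (uyy p + 3 * uxx p))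
        - u p * (- 2 * uy p * uxy p + u p * (pdx (pdx (pdx f)) q + pdy (pdy (pdx f)) q))) / u p ^ 3" (is ?x)
    and "pderiv_at 4 S33 p =
      (- 2 * uy p ^ 3 + uy p * (4 * a - 16 * b * p $ 2 - 2 * (ux p)\<^sup>2 + u p * (3 * uyy p + uxx p))
        - u p * (- 2 * ux p * uxy p + u p * (pdy (pdy (pdy f)) q + pdy (pdx (pdx f)) q))) / u p ^ 3" (is ?y)
proof -
  note M_cond[OF assms(1), simp]
  define E where "E z = (ux z)\<^sup>2 + (uy z)\<^sup>2 - u z * (uxx z + uyy z) - 2 * a + 8 * b * z $ 2" for z
  define Ex where "Ex = ux p * (uxx p - uyy p) + 2 * uy p * uxy p - u p * (pdx (pdx (pdx f)) q + pdy (pdy (pdx f)) q)"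
  define Ey where "Ey = uy p * (uyy p - uxx p) + 2 * ux p * uxy p - u p * (pdy (pdx (pdx f)) q + pdy (pdy (pdy f)) q)"
  have E: "(E has_derivative (\<lambda>h. 8 * b * h $ 2 + Ex * h $ 3 + Ey * h $ 4)) (at p)"
    unfolding E_def[abs_def] Ex_def Ey_def q_def
    by (rule derivative_eq_intros has_derivative_coordinate deriv_f deriv_fx deriv_fy deriv_fxx deriv_fyy
        assms(1) refl)+
      (simp add: pdx_pdy[OF assms(1)] pdx_pdy_pdy[OF assms(1)] algebra_simps)
  have "((\<lambda>z. E z / (u z)\<^sup>2) has_derivative
      (\<lambda>h. 8 * b / (u p)\<^sup>2 * h $ 2 + (u p * Ex - 2 * ux p * E p) / u p ^ 3 * h $ 3
         + (u p * Ey - 2 * uy p * E p) / u p ^ 3 * h $ 4)) (at p)"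
    by (rule derivative_eq_intros E deriv_f assms(1) refl)+
      (simp_all add: field_simps power2_eq_square power3_eq_cube)
  then have "pderiv_at k S33 p = vector [0, 8 * b / (u p)\<^sup>2, (u p * Ex - 2 * ux p * E p) / u p ^ 3,
      (u p * Ey - 2 * uy p * E p) / u p ^ 3] $ k" for k
    using pderiv_at_gradient4 by (simp add: S33_def[abs_def] E_def)
  then show ?x ?y
    by (simp_all add: E_def Ex_def Ey_def algebra_simps power2_eq_square power3_eq_cube)
qed

text \<open>The terms of the Lie derivative that differentiate \<open>\<xi>\<close> vanish because \<open>\<xi>\<close> is constant, and
  \<open>S\<^sub>1\<^sub>1\<close>, \<open>S\<^sub>1\<^sub>2\<close> are constant in the directions of \<open>\<xi>\<close> because they depend on \<open>r\<close> only.\<close>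

lemma lie_deriv_ricci_g:
  assumes "p \<in> M"
  shows "lie_deriv (\<lambda>p. \<mu>\<^sub>1 *\<^sub>R axis 3 1 + \<mu>\<^sub>2 *\<^sub>R axis 4 1) (ricci g) p $ i $ j =
    (if i = j \<and> (i = 3 \<or> i = 4) then \<mu>\<^sub>1 * pderiv_at 3 S33 p + \<mu>\<^sub>2 * pderiv_at 4 S33 p else 0)"
proof -
  have const: "pderiv_at k (\<lambda>z::real^4. c) p = 0" for k c
    by (simp add: pderiv_at_def)
  have radial: "pderiv_at k (\<lambda>z. \<phi> (z $ 2)) p = 0" if "k \<noteq> 2" for k :: 4 and \<phi>
    using that by (simp add: pderiv_at_def axis_def)
  have ricci: "pderiv_at k (\<lambda>z. ricci g z $ i $ j) p = pderiv_at k (\<lambda>z. ricci_table z $ i $ j) p" for k i j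
    using open_M assms by (rule pderiv_at_cong_open) (simp add: ricci_g)
  have S: "pderiv_at k (\<lambda>z. ricci_table z $ i $ j) p = (if i = j \<and> (i = 3 \<or> i = 4) then pderiv_at k S33 p else 0)"
    if "k = 3 \<or> k = 4" for k
    using exhaust_4[of i] exhaust_4[of j] that const
      radial[of k "\<lambda>r. - 8 * b * (d + r * (- a + 2 * b * r)) / r\<^sup>2"] radial[of k "\<lambda>r. - 4 * b / r"]
    unfolding ricci_table_def Let_def
    by auto
  show ?thesis
    by (auto simp: lie_deriv_def const sum_4 ricci S axis_def)
qed

end

theorem corollary4p2:
  fixes a b d \<mu>\<^sub>1 \<mu>\<^sub>2 :: real
    and I J :: "real set"
    and \<Omega> :: "(real^2) set"
    and f :: "real^2 \<Rightarrow> real"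
  assumes RT: "RT_spacetime I J \<Omega> f"
    and nonzero: "\<forall>p \<in> RT_domain I J \<Omega>.
      (let r = p $ 2; q = xy_part p; F = f q;
           fx = pdx f q; fy = pdy f q;
           fxx = pdx (pdx f) q; fyy = pdy (pdy f) q
       in fx^2 + fy^2 - F * (fxx + fyy) - 2 * a + 4 * b * r \<noteq> 0)"
    and cond: "\<forall>p \<in> RT_domain I J \<Omega>.
      (let r = p $ 2; q = xy_part p; F = f q;
           fx = pdx f q; fy = pdy f q;
           fxx = pdx (pdx f) q; fxy = pdy (pdx f) q; fyy = pdy (pdy f) q;
           fxxx = pdx (pdx (pdx f)) q; fxxy = pdy (pdx (pdx f)) q;
           fxyy = pdy (pdy (pdx f)) q; fyyy = pdy (pdy (pdy f)) q
       in \<mu>\<^sub>2 * (- 2 * fy^3 + fy * (4 * a - 16 * b * r - 2 * fx^2 + F * (3 * fyy + fxx))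
                  - F * (- 2 * fx * fxy + F * (fyyy + fxxy)))
          + \<mu>\<^sub>1 * (- 2 * fx^3 + fx * (4 * a - 16 * b * r - 2 * fy^2 + F * (fyy + 3 * fxx))
                  - F * (- 2 * fy * fxy + F * (fxxx + fxyy))) = 0)"
  shows "ricci_collineation_on (RT_domain I J \<Omega>) (RT_metric a b d f)
           (\<lambda>p. \<mu>\<^sub>1 *\<^sub>R axis 3 1 + \<mu>\<^sub>2 *\<^sub>R axis 4 1)"
proof -
  interpret Robinson_Trautman a b d I J \<Omega> f
    using RT by unfold_locales
  have "\<mu>\<^sub>1 * pderiv_at 3 S33 p + \<mu>\<^sub>2 * pderiv_at 4 S33 p = 0" if p: "p \<in> M" for p
    unfolding pderiv_S33[OF p] times_divide_eq_right add_divide_distrib[symmetric]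
    using cond[rule_format, OF p] by (simp add: Let_def add.commute)
  then show ?thesis
    unfolding ricci_collineation_on_def by (simp add: vec_eq_iff lie_deriv_ricci_g)
qed

end
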